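(* Let $\alpha,\beta,c,d>0$ and $l\ge 0$ be real constants with $\alpha<\frac{\beta(l+1)+l}{\beta+2}$ and $\alpha>l$. Let $u\not\equiv 0$ be any solution on $\mathbb{R}^+$ of $$\big(|u'|^{l}u'\big)'+c|u'|^{\alpha}u'+d|u|^{\beta}u=0$$ for which there is a constant $C>0$ with $$\forall t\ge 1,\quad E(t)\le C\,t^{-\frac{l+2}{\alpha-l}},\qquad\text{where } E(t)=\frac{l+1}{l+2}|u'(t)|^{l+2}+\frac{d}{\beta+2}|u(t)|^{\beta+2}.$$ Then $$\lim_{t\to+\infty}t^{\frac{1-\alpha+l}{\alpha-l}}|u(t)|=\frac{\alpha-l}{1-\alpha+l}\Big(\frac{l+1}{c(\alpha-l)}\Big)^{\frac{1}{\alpha-l}}$$ and $$\lim_{t\to+\infty}t^{\frac{1}{\alpha-l}}|u'(t)|=\Big(\frac{l+1}{c(\alpha-l)}\Big)^{\frac{1}{\alpha-l}}.$$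
   Context: $\mathbb{R}^+=[0,+\infty)$. A solution on $\mathbb{R}^+$ is a function $u\in\mathcal{C}^1(\mathbb{R}^+)$ with $|u'|^lu'\in\mathcal{C}^1(\mathbb{R}^+)$ which satisfies the equation at every point. *)

theory Defs
  imports "HOL-Analysis.Analysis"
begin

(* f is continuously differentiable on [0, oo) with derivative f'; the derivative at 0 is
   one-sided, and values outside [0, oo) are irrelevant. *)
definition C1_halfline :: "(real \<Rightarrow> real) \<Rightarrow> (real \<Rightarrow> real) \<Rightarrow> bool" where
  "C1_halfline f f' \<longleftrightarrow>
     (\<forall>t\<in>{0..}. (f has_real_derivative f' t) (at t within {0..})) \<and> continuous_on {0..} f'"

(* The second argument u' is the derivative of u (unique on [0, oo)).
   Isabelle has 0 powr 0 = 0; this does not matter in |u'|^l u' when l = 0, since the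
   factor u' vanishes there as well. *)
definition solution ::
    "real \<Rightarrow> real \<Rightarrow> real \<Rightarrow> real \<Rightarrow> real \<Rightarrow> (real \<Rightarrow> real) \<Rightarrow> (real \<Rightarrow> real) \<Rightarrow> bool" where
  "solution l \<alpha> \<beta> c d u u' \<longleftrightarrow>
     C1_halfline u u' \<and>
     (\<exists>w. C1_halfline (\<lambda>t. \<bar>u' t\<bar> powr l * u' t) w \<and>
          (\<forall>t\<ge>0. w t + c * \<bar>u' t\<bar> powr \<alpha> * u' t + d * \<bar>u t\<bar> powr \<beta> * u t = 0))"

definition energy ::
    "real \<Rightarrow> real \<Rightarrow> real \<Rightarrow> (real \<Rightarrow> real) \<Rightarrow> (real \<Rightarrow> real) \<Rightarrow> real \<Rightarrow> real" where
  "energy l \<beta> d u u' t =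
     (l + 1) / (l + 2) * \<bar>u' t\<bar> powr (l + 2) + d / (\<beta> + 2) * \<bar>u t\<bar> powr (\<beta> + 2)"

end

(* Put a = 1/(alpha - l). The hypothesis on alpha gives a > 1, so |u'| = O(t^-a) can be
   integrated from infinity and yields u = O(t^(1-a)); it also makes |u|^(beta+2) = o(t^(-(l+2)a)).
   Since E' = -c |u'|^(alpha+2) >= -M E^((alpha+2)/(l+2)), the energy of a nonzero solution is at
   least k t^(-(l+2)a), and this must come from u': hence |u'| >= k' t^-a eventually.
   Then z = |u'|^-(alpha-l) satisfies z' -> c (alpha - l)/(l + 1), because the restoring force
   d |u|^beta u is negligible against |u'|^(alpha+1). L'Hospital's rule for z/t gives the limit for u',
   and once more, for u/t^(1-a), the limit for u. *)
theory Submission imports Defs begin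

section \<open>Calculus: powers of absolute values, L'Hospital at infinity, comparison
  estimates\<close>

text \<open>Away from 0 this is the chain rule. At 0 the difference quotient has modulus |h|^(p-1),
  which tends to 0 because p > 1; the formula agrees since \<open>sgn 0 = 0\<close>.\<close>

lemma has_real_derivative_abs_powr:
  fixes x p :: real
  assumes "x \<noteq> 0 \<or> p > 1"
  shows "((\<lambda>x. \<bar>x\<bar> powr p) has_real_derivative p * \<bar>x\<bar> powr (p - 1) * sgn x) (at x)"
proof (cases "x = 0")
  case False
  have "((\<lambda>x. \<bar>x\<bar>) has_real_derivative sgn x) (at x)"
  proof (cases "x > 0")
    case True
    then show ?thesis
      by (auto intro: has_field_derivative_transform_within_open[OF DERIV_ident, of "{0<..}"])
  next
    case neg: False
    then show ?thesis using False
      by (auto intro: has_field_derivative_transform_within_open[OF DERIV_minus[OF DERIV_ident], of "{..<0}"])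
  qed
  from DERIV_fun_powr[OF this, of p] False show ?thesis by simp
next
  case True
  then have "p > 1" using assms by simp
  have "((\<lambda>h. \<bar>h\<bar> powr (p - 1)) \<longlongrightarrow> \<bar>0\<bar> powr (p - 1)) (at (0::real))"
    using \<open>p > 1\<close> by (intro tendsto_intros) auto
  then have *: "((\<lambda>h. \<bar>h\<bar> powr (p - 1)) \<longlongrightarrow> 0) (at (0::real))" by simp
  have "((\<lambda>h. \<bar>h\<bar> powr p / h) \<longlongrightarrow> 0) (at (0::real))"
  proof (rule Lim_null_comparison[OF _ *])
    show "\<forall>\<^sub>F h in at (0::real). norm (\<bar>h\<bar> powr p / h) \<le> \<bar>h\<bar> powr (p - 1)"
      by (auto simp: eventually_at_filter powr_diff)
  qed
  then show ?thesis
    using True by (simp add: DERIV_def)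
qed

text \<open>The substitution x -> 1/x reduces this to the 0/0 rule at 0 from the right. Both
  derivatives acquire the same factor -1/x^2, which cancels in the quotient.\<close>

lemma lhospital_zero_at_top:
  fixes f g f' g' :: "real \<Rightarrow> real"
  assumes "(f \<longlongrightarrow> 0) at_top" "(g \<longlongrightarrow> 0) at_top"
    and g: "\<forall>\<^sub>F x in at_top. g x \<noteq> 0" and g': "\<forall>\<^sub>F x in at_top. g' x \<noteq> 0"
    and df: "\<forall>\<^sub>F x in at_top. (f has_real_derivative f' x) (at x)"
    and dg: "\<forall>\<^sub>F x in at_top. (g has_real_derivative g' x) (at x)"
    and lim: "((\<lambda>x. f' x / g' x) \<longlongrightarrow> y) at_top"
  shows "((\<lambda>x. f x / g x) \<longlongrightarrow> y) at_top"
  unfolding filterlim_at_top_to_right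
proof (rule lhopital_right)
  let ?D = "\<lambda>f' x. f' (inverse x) * - (inverse x ^ Suc (Suc 0))"
  show "((\<lambda>x. f (inverse x)) \<longlongrightarrow> 0) (at_right 0)" "((\<lambda>x. g (inverse x)) \<longlongrightarrow> 0) (at_right 0)"
    using assms(1,2) by (simp_all only: filterlim_at_top_to_right)
  show "\<forall>\<^sub>F x in at_right 0. g (inverse x) \<noteq> 0"
    using g unfolding eventually_at_top_to_right .
  show "\<forall>\<^sub>F x in at_right 0. ?D g' x \<noteq> 0"
    using g'[unfolded eventually_at_top_to_right] eventually_at_right_less[of 0]
    by eventually_elim auto
  show "\<forall>\<^sub>F x in at_right 0. ((\<lambda>x. f (inverse x)) has_real_derivative ?D f' x) (at x)"
    using df[unfolded eventually_at_top_to_right] eventually_at_right_less[of 0]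
    by eventually_elim (rule derivative_eq_intros DERIV_chain'[where f=inverse] | simp)+
  show "\<forall>\<^sub>F x in at_right 0. ((\<lambda>x. g (inverse x)) has_real_derivative ?D g' x) (at x)"
    using dg[unfolded eventually_at_top_to_right] eventually_at_right_less[of 0]
    by eventually_elim (rule derivative_eq_intros DERIV_chain'[where f=inverse] | simp)+
  have "((\<lambda>x. f' (inverse x) / g' (inverse x)) \<longlongrightarrow> y) (at_right 0)"
    using lim unfolding filterlim_at_top_to_right .
  then show "((\<lambda>x. ?D f' x / ?D g' x) \<longlongrightarrow> y) (at_right 0)"
    by (rule Lim_transform_eventually)
      (use eventually_at_right_less[of "0::real"] in eventually_elim, auto)
qed

text \<open>Integration from infinity, phrased as monotonicity: the bound g has g' = -K t^(-a) and
  limit 0, so f - g and -f - g are nondecreasing with limit 0, hence nonpositive.\<close>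

lemma abs_le_powr_tail:
  fixes f f' :: "real \<Rightarrow> real"
  assumes "a > 1" "T > 0" "(f \<longlongrightarrow> 0) at_top"
    and df: "\<And>t. t \<ge> T \<Longrightarrow> (f has_real_derivative f' t) (at t)"
    and le: "\<And>t. t \<ge> T \<Longrightarrow> \<bar>f' t\<bar> \<le> K * t powr (- a)"
    and "t \<ge> T"
  shows "\<bar>f t\<bar> \<le> K / (a - 1) * t powr (1 - a)"
proof -
  define g where "g t = K / (a - 1) * t powr (1 - a)" for t
  have dg: "(g has_real_derivative - (K * t powr (- a))) (at t)" if "t \<ge> T" for t
  proof -
    have "t > 0" using that \<open>T > 0\<close> by simp
    from DERIV_cmult[OF has_real_derivative_powr[OF this, of "1 - a"], of "K / (a - 1)"]
    have "(g has_real_derivative K / (a - 1) * ((1 - a) * t powr (- a))) (at t)"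
      by (simp add: g_def[abs_def])
    also have "K / (a - 1) * ((1 - a) * t powr (- a)) = - (K * t powr (- a))"
      using \<open>a > 1\<close> by (simp add: divide_simps) (simp add: algebra_simps)
    finally show ?thesis .
  qed
  have "(g \<longlongrightarrow> 0) at_top"
    unfolding g_def using \<open>a > 1\<close>
    by (intro tendsto_mult_right_zero tendsto_neg_powr filterlim_ident) auto
  have aux: "h t \<le> 0" if h0: "(h \<longlongrightarrow> 0) at_top"
    and dh: "\<And>s. s \<ge> T \<Longrightarrow> \<exists>y. (h has_real_derivative y) (at s) \<and> y \<ge> 0" for h :: "real \<Rightarrow> real"
  proof (rule tendsto_lowerbound[OF h0])
    show "\<forall>\<^sub>F s in at_top. h t \<le> h s"
      using eventually_ge_at_top[of t]
      by eventually_elim (rule DERIV_nonneg_imp_nondecreasing, use dh \<open>t \<ge> T\<close> in auto)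
  qed simp
  have "f t - g t \<le> 0"
  proof (rule aux)
    show "((\<lambda>t. f t - g t) \<longlongrightarrow> 0) at_top"
      using tendsto_diff[OF assms(3) \<open>(g \<longlongrightarrow> 0) at_top\<close>] by simp
    show "\<exists>y. ((\<lambda>t. f t - g t) has_real_derivative y) (at s) \<and> y \<ge> 0" if "s \<ge> T" for s
      using DERIV_diff[OF df dg, OF that that] le[OF that] by (auto intro!: exI)
  qed
  moreover have "- f t - g t \<le> 0"
  proof (rule aux)
    show "((\<lambda>t. - f t - g t) \<longlongrightarrow> 0) at_top"
      using tendsto_diff[OF tendsto_minus[OF assms(3)] \<open>(g \<longlongrightarrow> 0) at_top\<close>] by simp
    show "\<exists>y. ((\<lambda>t. - f t - g t) has_real_derivative y) (at s) \<and> y \<ge> 0" if "s \<ge> T" for s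
      using DERIV_diff[OF DERIV_minus[OF df] dg, OF that that] le[OF that] by (auto intro!: exI)
  qed
  ultimately show ?thesis unfolding g_def by linarith
qed

text \<open>Bernoulli substitution: where f > 0, the derivative of f^(1-r) is at most (r-1) M. So
  f^(1-r) grows at most linearly, and inverting the power bounds f from below.\<close>

lemma powr_decay_lower_bound:
  fixes f f' :: "real \<Rightarrow> real"
  assumes "r > 1" "M \<ge> 0" "T > 0" "f T > 0"
    and nonneg: "\<And>t. t \<ge> T \<Longrightarrow> f t \<ge> 0"
    and df: "\<And>t. t \<ge> T \<Longrightarrow> (f has_real_derivative f' t) (at t)"
    and np: "\<And>t. t \<ge> T \<Longrightarrow> f' t \<le> 0"
    and ge: "\<And>t. t \<ge> T \<Longrightarrow> f' t \<ge> - M * f t powr r"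
  obtains k where "k > 0" "\<And>t. t \<ge> T \<Longrightarrow> f t \<ge> k * t powr (- (1 / (r - 1)))"
proof -
  have dec: "f t \<le> f T" if "t \<ge> T" for t
    using that by (rule DERIV_nonpos_imp_nonincreasing) (use df np in auto)
  \<comment> \<open>Since f is nonincreasing, f^r <= f(T)^(r-1) f, so the nonlinear inequality
    implies f' >= -K f. The integrating factor exp(K t) then keeps f positive, which the
    substitution requires.\<close>
  define K where "K = M * f T powr (r - 1)"
  have lin: "f' t \<ge> - K * f t" if "t \<ge> T" for t
  proof -
    have "f t powr r = f t powr (r - 1) * f t"
      using nonneg[OF that] \<open>r > 1\<close> by (cases "f t = 0") (auto simp: powr_diff)
    also have "\<dots> \<le> f T powr (r - 1) * f t"
      using dec nonneg that \<open>r > 1\<close> by (intro mult_right_mono powr_mono2) auto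
    finally have "M * f t powr r \<le> M * (f T powr (r - 1) * f t)"
      using \<open>M \<ge> 0\<close> by (rule mult_left_mono)
    then show ?thesis using ge[OF that] by (simp add: K_def mult_ac)
  qed
  have pos: "f t > 0" if "t \<ge> T" for t
  proof -
    have "f T * exp (K * T) \<le> f t * exp (K * t)"
      using that
    proof (rule DERIV_nonneg_imp_nondecreasing)
      fix s assume s: "T \<le> s"
      have "((\<lambda>t. f t * exp (K * t)) has_real_derivative (f' s + K * f s) * exp (K * s)) (at s)"
        by (rule derivative_eq_intros df[OF s] refl | simp add: algebra_simps)+
      moreover have "(f' s + K * f s) * exp (K * s) \<ge> 0"
        using lin[OF s] by simp
      ultimately show "\<exists>y. ((\<lambda>t. f t * exp (K * t)) has_real_derivative y) (at s) \<and> 0 \<le> y"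
        by blast
    qed
    moreover have "f T * exp (K * T) > 0" using \<open>f T > 0\<close> by simp
    ultimately show ?thesis by (smt (verit) exp_gt_zero zero_less_mult_pos2)
  qed
  define A where "A = f T powr (1 - r)"
  \<comment> \<open>The integration gives f^(1-r) <= A + (r-1) M t. Absorbing A into (A/T) t, valid
    for t >= T, leaves a pure multiple of t.\<close>
  define B where "B = A / T + (r - 1) * M"
  have "A > 0" using \<open>f T > 0\<close> by (simp add: A_def)
  then have "B > 0" unfolding B_def using assms(1-3) by (intro add_pos_nonneg) auto
  have up: "f t powr (1 - r) \<le> B * t" if "t \<ge> T" for t
  proof -
    have "f t powr (1 - r) - (r - 1) * M * t \<le> f T powr (1 - r) - (r - 1) * M * T"
      using that
    proof (rule DERIV_nonpos_imp_nonincreasing)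
      fix s assume s: "T \<le> s"
      have "((\<lambda>t. f t powr (1 - r) - (r - 1) * M * t) has_real_derivative
          (1 - r) * f s powr (- r) * f' s - (r - 1) * M) (at s)"
        by (rule derivative_eq_intros DERIV_fun_powr[OF df[OF s] pos[OF s], of "1 - r"] refl | simp)+
      moreover have "(1 - r) * f s powr (- r) * f' s - (r - 1) * M \<le> 0"
      proof -
        have "f s powr (- r) * (- f' s) \<le> f s powr (- r) * (M * f s powr r)"
          using ge[OF s] by (intro mult_left_mono) auto
        also have "\<dots> = M" using pos[OF s] by (simp add: powr_minus field_simps)
        finally have "(r - 1) * (f s powr (- r) * (- f' s)) \<le> (r - 1) * M"
          using \<open>r > 1\<close> by (intro mult_left_mono) auto
        then show ?thesis by (simp add: algebra_simps)
      qed
      ultimately show "\<exists>y. ((\<lambda>t. f t powr (1 - r) - (r - 1) * M * t) has_real_derivative y) (at s)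
          \<and> y \<le> 0" by blast
    qed
    moreover have "0 \<le> (r - 1) * M * T" using assms(1-3) by simp
    moreover have "A \<le> A / T * t" using that \<open>T > 0\<close> \<open>A > 0\<close> by (simp add: field_simps)
    ultimately show ?thesis unfolding B_def A_def[symmetric] by (simp add: algebra_simps)
  qed
  show thesis
  proof
    show "B powr (- (1 / (r - 1))) > 0" using \<open>B > 0\<close> by simp
    fix t assume t: "t \<ge> T"
    have "(B * t) powr (- (1 / (r - 1))) \<le> (f t powr (1 - r)) powr (- (1 / (r - 1)))"
      using up[OF t] pos[OF t] \<open>r > 1\<close> by (intro powr_mono2') auto
    also have "\<dots> = f t"
    proof -
      have "(1 - r) * (- (1 / (r - 1))) = 1" using \<open>r > 1\<close> by (simp add: field_simps)
      then show ?thesis using pos[OF t] by (simp only: powr_powr) simp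
    qed
    finally show "B powr (- (1 / (r - 1))) * t powr (- (1 / (r - 1))) \<le> f t"
      using \<open>B > 0\<close> t \<open>T > 0\<close> by (simp add: powr_mult)
  qed
qed


text \<open>Powers of the flux are powers of |x|. The case x = 0 holds for all exponents because
  \<open>0 powr y = 0\<close>.\<close>

lemma abs_abs_powr_times:
  fixes x q l :: real
  shows "\<bar>\<bar>x\<bar> powr l * x\<bar> powr q = \<bar>x\<bar> powr (q * (l + 1))"
proof (cases "x = 0")
  case False
  then have "\<bar>\<bar>x\<bar> powr l * x\<bar> = \<bar>x\<bar> powr (l + 1)"
    by (simp add: abs_mult powr_add)
  then show ?thesis by (simp add: powr_powr mult.commute)
qed simp

section \<open>The equation on t > 0 and its exponents\<close>

text \<open>Working on t > 0 makes all derivatives two-sided. The equation is already solved for the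
  derivative of the flux |u'|^l u'.\<close>

locale damped_oscillator =
  fixes \<alpha> \<beta> c d l :: real and u u' :: "real \<Rightarrow> real"
  assumes params: "\<beta> > 0" "c > 0" "d > 0" "l \<ge> 0" "\<alpha> > l"
    and \<alpha>_less: "\<alpha> < (\<beta> * (l + 1) + l) / (\<beta> + 2)"
    and deriv_u: "\<And>t. t > 0 \<Longrightarrow> (u has_real_derivative u' t) (at t)"
    and continuous_u': "continuous_on {0<..} u'"
    and deriv_flux: "\<And>t. t > 0 \<Longrightarrow> ((\<lambda>t. \<bar>u' t\<bar> powr l * u' t) has_real_derivative
          - c * \<bar>u' t\<bar> powr \<alpha> * u' t - d * \<bar>u t\<bar> powr \<beta> * u t) (at t)"
    and nontrivial: "\<exists>t>0. u t \<noteq> 0"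
    and decay: "\<exists>C>0. \<forall>t\<ge>1. energy l \<beta> d u u' t \<le> C * t powr (- ((l + 2) / (\<alpha> - l)))"
begin

text \<open>The rate at which inertia and damping balance: if |u'| behaves like t^(-a), then a (l+1)
  + 1 = a (\<alpha>+1).\<close>

definition a where "a = 1 / (\<alpha> - l)"

lemma \<alpha>_bound: "\<alpha> * (\<beta> + 2) < \<beta> * (l + 1) + l"
  using \<alpha>_less params(1) by (simp add: field_simps)

text \<open>The upper bound on \<alpha> lies below l + 1, so 0 < \<alpha> - l < 1.\<close>

lemma a_gt_1: "a > 1"
proof -
  have "\<alpha> * (\<beta> + 2) < (l + 1) * (\<beta> + 2)"
    using \<alpha>_bound params by (simp add: algebra_simps)
  then have "\<alpha> < l + 1" using params(1) by simp
  then show ?thesis using params by (simp add: a_def)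
qed

lemma a_times_\<alpha>: "a * \<alpha> = a * l + 1"
  using params by (simp add: a_def field_simps)

text \<open>For u = O(t^(1-a)) this makes the potential energy smaller than t^(-(l+2)a). The gap is
  a positive multiple of the gap in \<open>\<alpha>_bound\<close>; \<open>force_exponent\<close>
  involves the very same number.\<close>

lemma energy_exponent: "(1 - a) * (\<beta> + 2) < - ((l + 2) * a)"
proof -
  have "(1 - a) * (\<beta> + 2) + (l + 2) * a = a * (\<alpha> * (\<beta> + 2) - (\<beta> * (l + 1) + l))"
    using a_times_\<alpha> by algebra
  also have "\<dots> < 0" using \<alpha>_bound a_gt_1 by (intro mult_pos_neg) auto
  finally show ?thesis by simp
qed

lemma force_exponent: "(1 - a) * (\<beta> + 1) + a * (\<alpha> + 1) < 0"
proof -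
  have "(1 - a) * (\<beta> + 1) + a * (\<alpha> + 1) = a * (\<alpha> * (\<beta> + 2) - (\<beta> * (l + 1) + l))"
    using a_times_\<alpha> by algebra
  also have "\<dots> < 0" using \<alpha>_bound a_gt_1 by (intro mult_pos_neg) auto
  finally show ?thesis .
qed

section \<open>Energy dissipation\<close>

text \<open>\<open>u'\<close> itself need not be differentiable where it vanishes, so powers of \<open>\<bar>u'\<bar>\<close> are
  differentiated as powers of the flux \<open>\<bar>u'\<bar>\<^sup>l u'\<close>.\<close>

lemma deriv_abs_u'_powr:
  assumes "t > 0" "u' t \<noteq> 0 \<or> q > l + 1"
  shows "((\<lambda>t. \<bar>u' t\<bar> powr q) has_real_derivative
    q / (l + 1) * \<bar>u' t\<bar> powr (q - (l + 1)) * sgn (u' t) *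
      (- c * \<bar>u' t\<bar> powr \<alpha> * u' t - d * \<bar>u t\<bar> powr \<beta> * u t)) (at t)"
proof -
  have l: "l + 1 > 0" using params by simp
  define v where "v t = \<bar>u' t\<bar> powr l * u' t" for t
  have eq: "\<bar>v t\<bar> powr p = \<bar>u' t\<bar> powr (p * (l + 1))" for t p
    unfolding v_def by (rule abs_abs_powr_times)
  \<comment> \<open>The outer power is q/(l+1), so q > l + 1 provides the exponent above 1 that
    differentiability at a zero of the flux requires.\<close>
  have "((\<lambda>t. \<bar>v t\<bar> powr (q / (l + 1))) has_real_derivative
      q / (l + 1) * \<bar>v t\<bar> powr (q / (l + 1) - 1) * sgn (v t) *
      (- c * \<bar>u' t\<bar> powr \<alpha> * u' t - d * \<bar>u t\<bar> powr \<beta> * u t)) (at t)"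
    unfolding v_def
    by (rule DERIV_chain2[OF has_real_derivative_abs_powr deriv_flux[OF assms(1)]])
      (use assms(2) l in auto)
  moreover have "sgn (v t) = sgn (u' t)" 
    by (cases "u' t = 0") (simp_all add: v_def sgn_mult)
  moreover have "(q / (l + 1) - 1) * (l + 1) = q - (l + 1)" using l by (simp add: field_simps)
  ultimately show ?thesis using l by (simp add: eq)
qed

text \<open>Multiply the equation by u': the potential terms cancel and only the damping remains.
  Zeros of u' cause no trouble because l + 2 > l + 1.\<close>

lemma deriv_energy:
  assumes "t > 0"
  shows "(energy l \<beta> d u u' has_real_derivative - c * \<bar>u' t\<bar> powr (\<alpha> + 2)) (at t)"
proof -
  define W where "W = - c * \<bar>u' t\<bar> powr \<alpha> * u' t - d * \<bar>u t\<bar> powr \<beta> * u t"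
  have 1: "((\<lambda>t. \<bar>u' t\<bar> powr (l + 2)) has_real_derivative (l + 2) / (l + 1) * (u' t * W)) (at t)"
    using deriv_abs_u'_powr[OF assms, of "l + 2", folded W_def]
    by (simp add: abs_mult_sgn mult.assoc flip: mult.assoc[of "\<bar>_\<bar>" "sgn _"])
  have 2: "((\<lambda>t. \<bar>u t\<bar> powr (\<beta> + 2)) has_real_derivative
      (\<beta> + 2) * \<bar>u t\<bar> powr (\<beta> + 2 - 1) * sgn (u t) * u' t) (at t)"
    by (rule DERIV_chain2[OF has_real_derivative_abs_powr deriv_u[OF assms]]) (use params in simp)
  have e: "\<bar>u t\<bar> powr (\<beta> + 2 - 1) * sgn (u t) = \<bar>u t\<bar> powr \<beta> * u t"
    by (cases "u t = 0") (simp_all add: powr_add powr_diff power2_eq_square mult.assoc abs_mult_sgn)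
  have 2: "((\<lambda>t. \<bar>u t\<bar> powr (\<beta> + 2)) has_real_derivative
      (\<beta> + 2) * (\<bar>u t\<bar> powr \<beta> * u t * u' t)) (at t)"
    using 2 unfolding mult.assoc[of "\<beta> + 2"] e .
  have 3: "\<bar>u' t\<bar> powr (\<alpha> + 2) = \<bar>u' t\<bar> powr \<alpha> * (u' t * u' t)"
    by (cases "u' t = 0") (simp_all add: powr_add power2_eq_square)
  have "(energy l \<beta> d u u' has_real_derivative
     (l + 1) / (l + 2) * ((l + 2) / (l + 1) * (u' t * W)) +
     d / (\<beta> + 2) * ((\<beta> + 2) * (\<bar>u t\<bar> powr \<beta> * u t * u' t))) (at t)"
    unfolding energy_def[abs_def] by (intro DERIV_add DERIV_cmult 1 2)
  also have "(l + 1) / (l + 2) * ((l + 2) / (l + 1) * (u' t * W)) = u' t * W"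
    using params by simp
  also have "d / (\<beta> + 2) * ((\<beta> + 2) * (\<bar>u t\<bar> powr \<beta> * u t * u' t)) = d * \<bar>u t\<bar> powr \<beta> * u t * u' t"
    using params by simp
  also have "u' t * W + d * \<bar>u t\<bar> powr \<beta> * u t * u' t = - c * \<bar>u' t\<bar> powr (\<alpha> + 2)"
    by (simp add: W_def 3 algebra_simps)
  finally show ?thesis .
qed

lemma energy_nonneg: "energy l \<beta> d u u' t \<ge> 0"
  using params by (simp add: energy_def)

lemma abs_u'_le_energy: "\<bar>u' t\<bar> powr (l + 2) \<le> (l + 2) / (l + 1) * energy l \<beta> d u u' t"
proof -
  have "(l + 2) / (l + 1) * ((l + 1) / (l + 2) * \<bar>u' t\<bar> powr (l + 2))
      \<le> (l + 2) / (l + 1) * energy l \<beta> d u u' t"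
    using params by (intro mult_left_mono) (auto simp: energy_def)
  then show ?thesis using params by simp
qed

lemma abs_u_le_energy: "\<bar>u t\<bar> powr (\<beta> + 2) \<le> (\<beta> + 2) / d * energy l \<beta> d u u' t"
proof -
  have "(\<beta> + 2) / d * (d / (\<beta> + 2) * \<bar>u t\<bar> powr (\<beta> + 2))
      \<le> (\<beta> + 2) / d * energy l \<beta> d u u' t"
    using params by (intro mult_left_mono) (auto simp: energy_def)
  then show ?thesis using params by simp
qed

section \<open>Bounds for the energy, u and u' by powers of t\<close>

lemma energy_lower_bound:
  obtains k T where "k > 0" "T > 0"
    "\<And>t. t \<ge> T \<Longrightarrow> energy l \<beta> d u u' t \<ge> k * t powr (- ((l + 2) * a))"
proof -
  obtain T where T: "T > 0" "u T \<noteq> 0" using nontrivial by blast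
  \<comment> \<open>Chosen so that (|u'|^(l+2))^r = |u'|^(\<alpha>+2); bounding |u'|^(l+2) by the
    energy then turns the dissipation into M E^r. Moreover 1/(r-1) = (l+2) a.\<close>
  define r where "r = (\<alpha> + 2) / (l + 2)"
  have r: "r > 1" using params by (simp add: r_def)
  define M where "M = c * ((l + 2) / (l + 1)) powr r"
  have pos: "energy l \<beta> d u u' T > 0"
    using params T(2) by (auto simp: energy_def intro!: add_nonneg_pos)
  have dis: "- c * \<bar>u' t\<bar> powr (\<alpha> + 2) \<ge> - M * energy l \<beta> d u u' t powr r" for t
  proof -
    have "\<bar>u' t\<bar> powr (\<alpha> + 2) = (\<bar>u' t\<bar> powr (l + 2)) powr r"
      using params by (simp add: powr_powr r_def)
    also have "\<dots> \<le> ((l + 2) / (l + 1) * energy l \<beta> d u u' t) powr r"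
      using abs_u'_le_energy r by (intro powr_mono2) auto
    also have "\<dots> = ((l + 2) / (l + 1)) powr r * energy l \<beta> d u u' t powr r"
      by (rule powr_mult)
    finally show ?thesis using params by (simp add: M_def)
  qed
  have "r - 1 = (\<alpha> - l) / (l + 2)" using params by (simp add: r_def field_simps)
  then have e: "- (1 / (r - 1)) = - ((l + 2) * a)" using params by (simp add: a_def)
  show thesis
  proof (rule powr_decay_lower_bound[OF r _ T(1) pos energy_nonneg deriv_energy _ dis])
    show "M \<ge> 0" using params by (simp add: M_def)
    show "- c * \<bar>u' t\<bar> powr (\<alpha> + 2) \<le> 0" for t using params by simp
  qed (use T(1) that e in auto)
qed

lemma abs_u'_upper_bound:
  obtains K where "K > 0" "\<And>t. t \<ge> 1 \<Longrightarrow> \<bar>u' t\<bar> \<le> K * t powr (- a)"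
proof -
  obtain C where C: "C > 0" "\<And>t. t \<ge> 1 \<Longrightarrow> energy l \<beta> d u u' t \<le> C * t powr (- ((l + 2) / (\<alpha> - l)))"
    using decay by auto
  define K where "K = ((l + 2) / (l + 1) * C) powr (1 / (l + 2))"
  show thesis
  proof
    show "K > 0" using params C(1) by (simp add: K_def)
    fix t :: real assume t: "t \<ge> 1"
    have "\<bar>u' t\<bar> powr (l + 2) \<le> (l + 2) / (l + 1) * (C * t powr (- ((l + 2) / (\<alpha> - l))))"
      using params abs_u'_le_energy[of t] C(2)[OF t]
      by (elim order_trans) (intro mult_left_mono, auto)
    then have "(\<bar>u' t\<bar> powr (l + 2)) powr (1 / (l + 2)) \<le>
        ((l + 2) / (l + 1) * C * t powr (- ((l + 2) / (\<alpha> - l)))) powr (1 / (l + 2))"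
      using params by (intro powr_mono2) (auto simp: mult.assoc)
    also have "\<dots> = K * t powr (- a)"
      using params C(1) t by (simp add: powr_mult[of "(l + 2) / (l + 1) * C"] powr_powr K_def a_def del: times_divide_eq_left)
    finally show "\<bar>u' t\<bar> \<le> K * t powr (- a)"
      using params by (simp add: powr_powr)
  qed
qed

text \<open>The energy alone gives only |u| = O(t^(-(l+2)a/(\<beta>+2))), weaker than t^(1-a) by
  \<open>energy_exponent\<close>. It serves to fix the limit 0, from which integrating u' yields the
  sharper rate.\<close>

lemma u_tendsto_0: "(u \<longlongrightarrow> 0) at_top"
proof -
  obtain C where C: "C > 0" "\<And>t. t \<ge> 1 \<Longrightarrow> energy l \<beta> d u u' t \<le> C * t powr (- ((l + 2) / (\<alpha> - l)))"
    using decay by auto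
  have "((\<lambda>t::real. (\<beta> + 2) / d * (C * t powr (- ((l + 2) / (\<alpha> - l))))) \<longlongrightarrow> 0) at_top"
    using params by (intro tendsto_mult_right_zero tendsto_neg_powr filterlim_ident) auto
  then have "((\<lambda>t. \<bar>u t\<bar> powr (\<beta> + 2)) \<longlongrightarrow> 0) at_top"
  proof (rule Lim_null_comparison[rotated])
    show "\<forall>\<^sub>F t in at_top. norm (\<bar>u t\<bar> powr (\<beta> + 2)) \<le> (\<beta> + 2) / d * (C * t powr (- ((l + 2) / (\<alpha> - l))))"
      using eventually_ge_at_top[of "1::real"]
    proof eventually_elim
      case (elim t)
      have "\<bar>u t\<bar> powr (\<beta> + 2) \<le> (\<beta> + 2) / d * energy l \<beta> d u u' t" by (rule abs_u_le_energy)
      also have "\<dots> \<le> (\<beta> + 2) / d * (C * t powr (- ((l + 2) / (\<alpha> - l))))"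
        using params C(2)[OF elim] by (intro mult_left_mono) auto
      finally show ?case by simp
    qed
  qed
  from tendsto_powr2[OF this tendsto_const, of "1 / (\<beta> + 2)"] params
  have "((\<lambda>t. (\<bar>u t\<bar> powr (\<beta> + 2)) powr (1 / (\<beta> + 2))) \<longlongrightarrow> 0) at_top" by simp
  then have "((\<lambda>t. \<bar>u t\<bar>) \<longlongrightarrow> 0) at_top"
    using params by (simp add: powr_powr)
  then show ?thesis by (rule tendsto_rabs_zero_cancel)
qed

lemma abs_u_upper_bound:
  obtains K where "K > 0" "\<And>t. t \<ge> 1 \<Longrightarrow> \<bar>u t\<bar> \<le> K * t powr (1 - a)"
proof -
  obtain K where K: "K > 0" "\<And>t. t \<ge> 1 \<Longrightarrow> \<bar>u' t\<bar> \<le> K * t powr (- a)"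
    by (rule abs_u'_upper_bound) blast
  show thesis
  proof
    show "K / (a - 1) > 0" using K(1) a_gt_1 by simp
    show "\<bar>u t\<bar> \<le> K / (a - 1) * t powr (1 - a)" if "t \<ge> 1" for t
      by (rule abs_le_powr_tail[where T = 1 and f' = u'])
        (use a_gt_1 u_tendsto_0 deriv_u K(2) that in auto)
  qed
qed

text \<open>The potential energy is eventually less than half of the lower bound for the total
  energy, so the kinetic part must supply the other half.\<close>

lemma abs_u'_lower_bound:
  obtains k T where "k > 0" "T > 0" "\<And>t. t \<ge> T \<Longrightarrow> \<bar>u' t\<bar> \<ge> k * t powr (- a)"
proof -
  obtain k T where k: "k > 0" "T > 0"
    and kT: "\<And>t. t \<ge> T \<Longrightarrow> energy l \<beta> d u u' t \<ge> k * t powr (- ((l + 2) * a))"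
    by (rule energy_lower_bound) blast
  obtain K where K: "K > 0" "\<And>t. t \<ge> 1 \<Longrightarrow> \<bar>u t\<bar> \<le> K * t powr (1 - a)"
    by (rule abs_u_upper_bound) blast
  define K' where "K' = d / (\<beta> + 2) * K powr (\<beta> + 2)"
  define \<epsilon> where "\<epsilon> = - ((l + 2) * a) - (1 - a) * (\<beta> + 2)"
  have \<epsilon>: "\<epsilon> > 0" using energy_exponent by (simp add: \<epsilon>_def)
  have "((\<lambda>t::real. K' * t powr (- \<epsilon>)) \<longlongrightarrow> 0) at_top"
    using \<epsilon> by (intro tendsto_mult_right_zero tendsto_neg_powr filterlim_ident) auto
  then have "\<forall>\<^sub>F t in at_top. K' * t powr (- \<epsilon>) < k / 2"
    using k by (intro order_tendstoD) auto
  then obtain S where S: "\<And>t. t \<ge> S \<Longrightarrow> K' * t powr (- \<epsilon>) < k / 2"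
    by (auto simp: eventually_at_top_linorder)
  \<comment> \<open>Solves (l+1)/(l+2) k'^(l+2) = k/2, the share left to the kinetic part.\<close>
  define k' where "k' = ((l + 2) / (l + 1) * (k / 2)) powr (1 / (l + 2))"
  show thesis
  proof
    show "k' > 0" using params k by (simp add: k'_def)
    show "max 1 (max S T) > 0" by simp
    fix t assume "t \<ge> max 1 (max S T)"
    then have t: "t \<ge> 1" "t \<ge> S" "t \<ge> T" by auto
    have "d / (\<beta> + 2) * \<bar>u t\<bar> powr (\<beta> + 2) \<le> d / (\<beta> + 2) * (K * t powr (1 - a)) powr (\<beta> + 2)"
      using params K(2)[OF t(1)] by (intro mult_left_mono powr_mono2) auto
    also have "\<dots> = K' * t powr ((1 - a) * (\<beta> + 2))"
      using K(1) by (simp add: K'_def powr_mult powr_powr)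
    also have "(1 - a) * (\<beta> + 2) = - \<epsilon> + (- ((l + 2) * a))" by (simp add: \<epsilon>_def)
    also have "K' * t powr \<dots> = (K' * t powr (- \<epsilon>)) * t powr (- ((l + 2) * a))"
      using powr_add by (metis mult.assoc)
    also have "\<dots> \<le> k / 2 * t powr (- ((l + 2) * a))"
      using S[OF t(2)] by (intro mult_right_mono) auto
    finally have "(l + 1) / (l + 2) * \<bar>u' t\<bar> powr (l + 2) \<ge> k / 2 * t powr (- ((l + 2) * a))"
      using kT[OF t(3)] unfolding energy_def by linarith
    then have "(l + 2) / (l + 1) * (k / 2 * t powr (- ((l + 2) * a)))
        \<le> (l + 2) / (l + 1) * ((l + 1) / (l + 2) * \<bar>u' t\<bar> powr (l + 2))"
      using params by (intro mult_left_mono) auto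
    then have "(l + 2) / (l + 1) * (k / 2) * t powr (- ((l + 2) * a)) \<le> \<bar>u' t\<bar> powr (l + 2)"
      using params by simp
    then have "((l + 2) / (l + 1) * (k / 2) * t powr (- ((l + 2) * a))) powr (1 / (l + 2))
        \<le> (\<bar>u' t\<bar> powr (l + 2)) powr (1 / (l + 2))"
      using params k by (intro powr_mono2) auto
    also have "\<dots> = \<bar>u' t\<bar>" using params by (simp add: powr_powr)
    also have "((l + 2) / (l + 1) * (k / 2) * t powr (- ((l + 2) * a))) powr (1 / (l + 2))
        = k' * (t powr (- ((l + 2) * a))) powr (1 / (l + 2))"
      unfolding k'_def by (rule powr_mult)
    also have "(t powr (- ((l + 2) * a))) powr (1 / (l + 2)) = t powr (- a)"
      using params by (simp add: powr_powr)
    finally show "\<bar>u' t\<bar> \<ge> k' * t powr (- a)" .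
  qed
qed

section \<open>Limits of the rescaled u' and u\<close>

text \<open>The ratio of restoring force to damping, up to constants. The upper bound on u and the
  lower bound on u' give the power t^e, with e < 0 by \<open>force_exponent\<close>.\<close>

lemma force_negligible: "((\<lambda>t. \<bar>u t\<bar> powr (\<beta> + 1) * \<bar>u' t\<bar> powr (- (\<alpha> + 1))) \<longlongrightarrow> 0) at_top"
proof -
  obtain k T where k: "k > 0" "T > 0" and kT: "\<And>t. t \<ge> T \<Longrightarrow> \<bar>u' t\<bar> \<ge> k * t powr (- a)"
    by (rule abs_u'_lower_bound) blast
  obtain K where K: "K > 0" "\<And>t. t \<ge> 1 \<Longrightarrow> \<bar>u t\<bar> \<le> K * t powr (1 - a)"
    by (rule abs_u_upper_bound) blast
  define B where "B = K powr (\<beta> + 1) * k powr (- (\<alpha> + 1))"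
  define e where "e = (1 - a) * (\<beta> + 1) + a * (\<alpha> + 1)"
  show ?thesis
  proof (rule Lim_null_comparison)
    show "((\<lambda>t. B * t powr e) \<longlongrightarrow> 0) at_top"
      using force_exponent unfolding e_def
      by (intro tendsto_mult_right_zero tendsto_neg_powr filterlim_ident)
    show "\<forall>\<^sub>F t in at_top. norm (\<bar>u t\<bar> powr (\<beta> + 1) * \<bar>u' t\<bar> powr (- (\<alpha> + 1))) \<le> B * t powr e"
      using eventually_ge_at_top[of "max 1 T"]
    proof eventually_elim
      case (elim t)
      then have t: "t \<ge> 1" "t \<ge> T" by auto
      have "\<bar>u t\<bar> powr (\<beta> + 1) * \<bar>u' t\<bar> powr (- (\<alpha> + 1))
          \<le> (K * t powr (1 - a)) powr (\<beta> + 1) * (k * t powr (- a)) powr (- (\<alpha> + 1))"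
        using K(2)[OF t(1)] kT[OF t(2)] params k t
        by (intro mult_mono powr_mono2 powr_mono2') auto
      also have "\<dots> = B * (t powr ((1 - a) * (\<beta> + 1)) * t powr (- a * (- (\<alpha> + 1))))"
        using K(1) k by (simp only: powr_mult powr_powr B_def mult_ac)
      also have "\<dots> = B * t powr e"
        by (simp add: powr_add[symmetric] e_def algebra_simps)
      finally show ?case by simp
    qed
  qed
qed

text \<open>Without the restoring force, z would be affine with slope m. The force perturbs z' only
  by a term tending to 0, so z/t still tends to m.\<close>

lemma abs_u'_asymp:
  "((\<lambda>t. t powr a * \<bar>u' t\<bar>) \<longlongrightarrow> ((l + 1) / (c * (\<alpha> - l))) powr a) at_top"
proof -
  obtain k T where k: "k > 0" "T > 0" and kT: "\<And>t. t \<ge> T \<Longrightarrow> \<bar>u' t\<bar> \<ge> k * t powr (- a)"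
    by (rule abs_u'_lower_bound) blast
  have nz: "u' t \<noteq> 0" if "t \<ge> T" for t
  proof -
    have "k * t powr (- a) > 0" using that k by simp
    then show ?thesis using kT[OF that] by auto
  qed
  define m where "m = c * (\<alpha> - l) / (l + 1)"
  have m: "m > 0" using params by (simp add: m_def)
  define z where "z t = \<bar>u' t\<bar> powr (- (\<alpha> - l))" for t
  define z' where "z' t = (\<alpha> - l) / (l + 1) *
      (c + d * (sgn (u' t) * sgn (u t)) * (\<bar>u t\<bar> powr (\<beta> + 1) * \<bar>u' t\<bar> powr (- (\<alpha> + 1))))" for t
  have dz: "(z has_real_derivative z' t) (at t)" if "t \<ge> T" for t
  proof -
    have n: "u' t \<noteq> 0" and "t > 0" using nz that k by auto
    have e: "- (\<alpha> - l) - (l + 1) = - (\<alpha> + 1)" by simp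
    have 1: "\<bar>u' t\<bar> powr (- (\<alpha> + 1)) * (\<bar>u' t\<bar> powr \<alpha> * (sgn (u' t) * u' t)) = 1"
    proof -
      have "sgn (u' t) * u' t = \<bar>u' t\<bar>" by (simp add: abs_sgn mult.commute)
      then have "\<bar>u' t\<bar> powr \<alpha> * (sgn (u' t) * u' t) = \<bar>u' t\<bar> powr (\<alpha> + 1)"
        using n by (simp add: powr_add)
      then show ?thesis using n by (simp add: powr_add[symmetric])
    qed
    have 2: "\<bar>u t\<bar> powr (\<beta> + 1) * sgn (u t) = \<bar>u t\<bar> powr \<beta> * u t"
      by (cases "u t = 0") (simp_all add: powr_add mult.assoc abs_mult_sgn)
    have "- (\<alpha> - l) / (l + 1) * \<bar>u' t\<bar> powr (- (\<alpha> + 1)) * sgn (u' t) *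
        (- c * \<bar>u' t\<bar> powr \<alpha> * u' t - d * \<bar>u t\<bar> powr \<beta> * u t) =
      (\<alpha> - l) / (l + 1) * (c * (\<bar>u' t\<bar> powr (- (\<alpha> + 1)) * (\<bar>u' t\<bar> powr \<alpha> * (sgn (u' t) * u' t)))
        + d * sgn (u' t) * (\<bar>u t\<bar> powr \<beta> * u t) * \<bar>u' t\<bar> powr (- (\<alpha> + 1)))"
      using params by (simp add: field_simps)
    also have "\<dots> = z' t" unfolding 1 2[symmetric] z'_def by (simp add: mult_ac)
    finally show ?thesis
      using deriv_abs_u'_powr[OF \<open>t > 0\<close>, of "- (\<alpha> - l)"] n unfolding z_def e by simp
  qed
  \<comment> \<open>The signs have modulus at most 1, so their behaviour does not affect the
    limit.\<close>
  have "((\<lambda>t. d * (sgn (u' t) * sgn (u t)) * (\<bar>u t\<bar> powr (\<beta> + 1) * \<bar>u' t\<bar> powr (- (\<alpha> + 1)))) \<longlongrightarrow> 0) at_top"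
    by (rule Lim_null_comparison[OF _ tendsto_mult_right_zero[OF force_negligible, of d]])
      (use params in \<open>auto simp: abs_mult abs_sgn_eq intro!: always_eventually mult_nonneg_nonneg\<close>)
  then have "(z' \<longlongrightarrow> (\<alpha> - l) / (l + 1) * (c + 0)) at_top"
    unfolding z'_def by (intro tendsto_intros)
  \<comment> \<open>The 1 is the derivative of the denominator t in z/t; this form of L'Hospital's
    rule requires only that the denominator tend to infinity.\<close>
  then have "((\<lambda>t. z' t / 1) \<longlongrightarrow> m) at_top" by (simp add: m_def mult.commute)
  then have "((\<lambda>t. z t / t) \<longlongrightarrow> m) at_top"
    by (rule lhospital_at_top_at_top[OF filterlim_ident, rotated -1])
      (auto intro!: eventually_mono[OF eventually_ge_at_top[of T]] dz)
  then have lim: "((\<lambda>t. (z t / t) powr (- a)) \<longlongrightarrow> m powr (- a)) at_top"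
    using m by (intro tendsto_intros) auto
  have "m powr (- a) = ((l + 1) / (c * (\<alpha> - l))) powr a"
    using params by (simp add: powr_minus m_def powr_divide powr_mult)
  moreover have "\<forall>\<^sub>F t in at_top. (z t / t) powr (- a) = t powr a * \<bar>u' t\<bar>"
    using eventually_ge_at_top[of T]
  proof eventually_elim
    case (elim t)
    \<comment> \<open>Hence raising z to the power -a recovers |u'|.\<close>
    have "- (\<alpha> - l) * - a = 1" using params by (simp add: a_def flip: minus_diff_eq[of \<alpha>] del: minus_diff_eq)
    then have "z t powr (- a) = \<bar>u' t\<bar>"
      unfolding z_def powr_powr using nz[OF elim] by simp
    moreover have "t powr (- a) = inverse (t powr a)" by (rule powr_minus)
    ultimately show ?case unfolding powr_divide by (simp add: field_simps)
  qed
  ultimately show ?thesis using Lim_transform_eventually[OF lim] by simp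
qed

text \<open>A continuous function without zeros on a half-line keeps its sign. This upgrades the
  limit for |u'| to one for u', as L'Hospital's rule for u demands.\<close>

lemma u'_constant_sign:
  obtains s T where "\<bar>s\<bar> = 1" "T > 0" "\<And>t. t \<ge> T \<Longrightarrow> u' t = s * \<bar>u' t\<bar>"
proof -
  obtain k T where k: "k > 0" "T > 0" and kT: "\<And>t. t \<ge> T \<Longrightarrow> \<bar>u' t\<bar> \<ge> k * t powr (- a)"
    by (rule abs_u'_lower_bound) blast
  have nz: "0 \<notin> u' ` {T..}"
  proof
    assume "0 \<in> u' ` {T..}"
    then obtain t where "t \<ge> T" "u' t = 0" by auto
    moreover have "k * t powr (- a) > 0" using \<open>t \<ge> T\<close> k by simp
    ultimately show False using kT[of t] by simp
  qed
  have "connected (u' ` {T..})"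
    by (rule connected_continuous_image)
      (use k in \<open>auto intro: continuous_on_subset[OF continuous_u']\<close>)
  then have same: "u' t > 0 \<longleftrightarrow> u' T > 0" if "t \<ge> T" for t
    using nz that connectedD_interval[of "u' ` {T..}" "u' t" "u' T" 0]
      connectedD_interval[of "u' ` {T..}" "u' T" "u' t" 0]
    by (metis atLeast_iff imageI linorder_not_less order_le_less order_refl)
  show thesis
  proof
    show "\<bar>if u' T > 0 then 1 else - 1 :: real\<bar> = 1" by simp
    show "T > 0" by fact
    show "u' t = (if u' T > 0 then 1 else - 1) * \<bar>u' t\<bar>" if "t \<ge> T" for t
      using same[OF that] by auto
  qed
qed

text \<open>Both u and t^(1-a) vanish at infinity, so the ratio of derivatives decides. The factor
  1/(a-1) comes from differentiating t^(1-a); the sign s disappears on taking absolute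
  values.\<close>

lemma abs_u_asymp:
  "((\<lambda>t. t powr (a - 1) * \<bar>u t\<bar>) \<longlongrightarrow> ((l + 1) / (c * (\<alpha> - l))) powr a / (a - 1)) at_top"
proof -
  define L where "L = ((l + 1) / (c * (\<alpha> - l))) powr a"
  obtain s T where s: "\<bar>s\<bar> = 1" "T > 0" "\<And>t. t \<ge> T \<Longrightarrow> u' t = s * \<bar>u' t\<bar>"
    by (rule u'_constant_sign) blast
  have "((\<lambda>t. s / (1 - a) * (t powr a * \<bar>u' t\<bar>)) \<longlongrightarrow> s / (1 - a) * L) at_top"
    unfolding L_def by (intro tendsto_intros abs_u'_asymp)
  moreover have "\<forall>\<^sub>F t in at_top. s / (1 - a) * (t powr a * \<bar>u' t\<bar>) = u' t / ((1 - a) * t powr (- a))"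
    using eventually_ge_at_top[of T]
  proof eventually_elim
    case (elim t)
    have "s / (1 - a) * (t powr a * \<bar>u' t\<bar>) = (s * \<bar>u' t\<bar>) * t powr a / (1 - a)" by simp
    also have "s * \<bar>u' t\<bar> = u' t" using s(3)[OF elim] by simp
    finally show ?case using elim s(2) by (simp add: powr_minus field_simps)
  qed
  ultimately have "((\<lambda>t. u' t / ((1 - a) * t powr (- a))) \<longlongrightarrow> s / (1 - a) * L) at_top"
    by (rule Lim_transform_eventually)
  then have "((\<lambda>t. u t / t powr (1 - a)) \<longlongrightarrow> s / (1 - a) * L) at_top"
  proof (rule lhospital_zero_at_top[OF u_tendsto_0, rotated -1])
    show "((\<lambda>t. t powr (1 - a)) \<longlongrightarrow> 0) at_top"
      using a_gt_1 by (intro tendsto_neg_powr filterlim_ident) auto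
    note gt = eventually_mono[OF eventually_gt_at_top[of "0::real"]]
    show "\<forall>\<^sub>F t::real in at_top. t powr (1 - a) \<noteq> 0" by (rule gt) simp
    show "\<forall>\<^sub>F t in at_top. (1 - a) * t powr (- a) \<noteq> 0" by (rule gt) (use a_gt_1 in simp)
    show "\<forall>\<^sub>F t in at_top. (u has_real_derivative u' t) (at t)" by (rule gt) (rule deriv_u)
    show "\<forall>\<^sub>F t in at_top. ((\<lambda>t. t powr (1 - a)) has_real_derivative (1 - a) * t powr (- a)) (at t)"
      by (rule gt) (use has_real_derivative_powr[of _ "1 - a"] in simp)
  qed
  then have "((\<lambda>t. \<bar>u t / t powr (1 - a)\<bar>) \<longlongrightarrow> \<bar>s / (1 - a) * L\<bar>) at_top"
    by (rule tendsto_rabs)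
  moreover have "\<bar>s / (1 - a) * L\<bar> = L / (a - 1)"
    using s(1) a_gt_1 by (simp add: abs_mult L_def)
  moreover have "\<bar>u t / t powr (1 - a)\<bar> = t powr (a - 1) * \<bar>u t\<bar>" for t
    using powr_minus_divide[of t "1 - a"] by simp
  ultimately show ?thesis by (simp add: L_def)
qed

end

section \<open>Transfer to solutions on the closed half-line\<close>

theorem theorem6p2:
  fixes \<alpha> \<beta> c d l :: real and u u' :: "real \<Rightarrow> real"
  assumes "\<alpha> > 0" and "\<beta> > 0" and "c > 0" and "d > 0" and "l \<ge> 0"
    and "\<alpha> < (\<beta> * (l + 1) + l) / (\<beta> + 2)" and "\<alpha> > l"
    and "solution l \<alpha> \<beta> c d u u'"
    and "\<exists>t\<ge>0. u t \<noteq> 0"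
    and "\<exists>C>0. \<forall>t\<ge>1. energy l \<beta> d u u' t \<le> C * t powr (- ((l + 2) / (\<alpha> - l)))"
  shows "((\<lambda>t. t powr ((1 - \<alpha> + l) / (\<alpha> - l)) * \<bar>u t\<bar>) \<longlongrightarrow>
            (\<alpha> - l) / (1 - \<alpha> + l) * ((l + 1) / (c * (\<alpha> - l))) powr (1 / (\<alpha> - l))) at_top
       \<and> ((\<lambda>t. t powr (1 / (\<alpha> - l)) * \<bar>u' t\<bar>) \<longlongrightarrow>
            ((l + 1) / (c * (\<alpha> - l))) powr (1 / (\<alpha> - l))) at_top"
proof -
  obtain w where C1: "C1_halfline u u'" "C1_halfline (\<lambda>t. \<bar>u' t\<bar> powr l * u' t) w"
    and eq: "\<And>t. t \<ge> 0 \<Longrightarrow> w t + c * \<bar>u' t\<bar> powr \<alpha> * u' t + d * \<bar>u t\<bar> powr \<beta> * u t = 0"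
    using assms(8) by (auto simp: solution_def)
  have at: "at t within {0..} = at t" if "t > 0" for t :: real
    using that by (intro at_within_interior) simp
  have du0: "(u has_real_derivative u' t) (at t within {0..})" if "t \<ge> 0" for t
    using C1(1) that by (simp add: C1_halfline_def)
  interpret damped_oscillator \<alpha> \<beta> c d l u u'
  proof
    show "(u has_real_derivative u' t) (at t)" if "t > 0" for t
      using du0[of t] that by (simp add: at)
    show "continuous_on {0<..} u'"
      by (rule continuous_on_subset[of "{0..}"]) (use C1(1) in \<open>auto simp: C1_halfline_def\<close>)
    show "((\<lambda>t. \<bar>u' t\<bar> powr l * u' t) has_real_derivative
        - c * \<bar>u' t\<bar> powr \<alpha> * u' t - d * \<bar>u t\<bar> powr \<beta> * u t) (at t)" if "t > 0" for t
    proof -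
      have "- c * \<bar>u' t\<bar> powr \<alpha> * u' t - d * \<bar>u t\<bar> powr \<beta> * u t = w t"
        using eq[of t] that by simp
      then show ?thesis using C1(2) that by (auto simp: C1_halfline_def at dest!: bspec[of _ _ t])
    qed
    \<comment> \<open>A solution vanishing for all t > 0 would also vanish at 0 by right
      continuity.\<close>
    show "\<exists>t>0. u t \<noteq> 0"
    proof (rule ccontr)
      assume z: "\<not> ?thesis"
      have "(u \<longlongrightarrow> u 0) (at 0 within {0..})"
        using DERIV_continuous[OF du0[of 0]] by (simp add: continuous_within)
      moreover have "(u \<longlongrightarrow> 0) (at 0 within {0..})"
        by (rule tendsto_eventually) (use z in \<open>auto simp: eventually_at_filter\<close>)
      moreover have "at (0::real) within {0..} \<noteq> bot"
        by (simp add: at_within_Ici_at_right)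
      ultimately have "u 0 = 0" by (metis tendsto_unique)
      with z assms(9) show False by (metis order_le_less)
    qed
  qed (use assms in auto)
  \<comment> \<open>Identifies both the power of t multiplying |u| and, inverted, the prefactor of
    its limit.\<close>
  have "a - 1 = (1 - \<alpha> + l) / (\<alpha> - l)" using assms(7) by (simp add: a_def field_simps)
  then show ?thesis
    using abs_u_asymp abs_u'_asymp by (simp add: a_def mult.commute)
qed

end
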